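(* Let $k,n,m\ge 1$ be integers and let $K_{n,m}$ be the complete bipartite graph with parts of sizes $n$ and $m$. If the vertices of $K_{n,m}$ are colored uniformly and independently with $k$ colors, the expected number of blocks is $$\mathbb{E}[X_k(K_{n,m})] =\frac{nk^n(k-1)^m+mk^m(k-1)^n+k(k^n-(k-1)^n)(k^m-(k-1)^m)}{k^{n+m}}.$$
   Context: Given a coloring of the vertices of a finite graph $G$ with $k$ colors, the blocks are the connected components of the subgraph of $G$ formed by all vertices and all edges whose two endpoints have the same color. $X_k(G)$ denotes the number of blocks when each vertex of $G$ receives independently a uniformly random color among $k$ colors. *)

theory Defs
  imports
    "HOL-Probability.Product_PMF"
    "Graph_Theory.Graph_Theory"
begin

text \<open>
  Undirected graphs are symmetric digraphs, as in the locale \<open>graph\<close>: an undirected edge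
  is a pair of opposite arcs, and both are kept or dropped together below.
\<close>

definition monochromatic_subgraph ::
    "('a, 'b) pre_digraph \<Rightarrow> ('a \<Rightarrow> 'c) \<Rightarrow> ('a, 'b) pre_digraph" where
  "monochromatic_subgraph G c = G\<lparr>arcs := {e \<in> arcs G. c (tail G e) = c (head G e)}\<rparr>"

definition connected_components :: "('a, 'b) pre_digraph \<Rightarrow> ('a, 'b) pre_digraph set" where
  "connected_components G = {H. pre_digraph.max_subgraph G Digraph_Component.connected H}"

definition blocks :: "('a, 'b) pre_digraph \<Rightarrow> ('a \<Rightarrow> 'c) \<Rightarrow> ('a, 'b) pre_digraph set" where
  "blocks G c = connected_components (monochromatic_subgraph G c)"

text \<open>
  The colors are \<open>{..<k}\<close>. The value 0 that the coloring takes outside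
  the vertex set is never inspected.
\<close>

definition uniform_coloring :: "nat \<Rightarrow> ('a, 'b) pre_digraph \<Rightarrow> ('a \<Rightarrow> nat) pmf" where
  "uniform_coloring k G = Pi_pmf (verts G) 0 (\<lambda>_. pmf_of_set {..<k})"

definition expected_blocks :: "nat \<Rightarrow> ('a, 'b) pre_digraph \<Rightarrow> real" where
  "expected_blocks k G =
     measure_pmf.expectation (uniform_coloring k G) (\<lambda>c. real (card (blocks G c)))"

end

theory Submission
  imports Defs
begin

text \<open>
  In a coloring of \<open>K\<^bsub>n,m\<^esub>\<close> with parts \<open>U\<close> and \<open>V\<close>, a vertex whose color does not occur in the
  opposite part is a block on its own, and every color occurring in both parts contributes
  exactly one further block, its whole color class. By linearity of expectation it remains to
  compute the probabilities that a vertex of one part avoids all colors of the other part,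
  and that a given color occurs in both parts.
\<close>

section \<open>Connected components of symmetric digraphs\<close>

text \<open>A connected subgraph with the same vertex set is spanning, so it already connects the
  larger graph. This is what makes maximal connected subgraphs induced.\<close>

lemma arc_mono_connected: "arc_mono Digraph_Component.connected"
  unfolding arc_mono_def
  by (metis spanning_def subgraphE wf_digraph.connected_spanning_imp_connected)

lemma (in wf_digraph) strongly_connected_imp_connected:
  assumes "strongly_connected G"
  shows "Digraph_Component.connected G"
  using assms by (intro connectedI reachable_mk_symmetricI) (auto simp: strongly_connected_def)

text \<open>Induced subgraphs of a symmetric digraph are symmetric, and there connected and strongly
  connected coincide. Blocks can thus be counted through \<open>sccs\<close> and
  \<open>scc_of\<close>.\<close>

lemma (in sym_digraph) connected_components_eq_sccs: "connected_components G = sccs"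
proof -
  have induced: "strongly_connected K"
    if "induced_subgraph K G" "Digraph_Component.connected K" for K
    using that sym_digraph.sym_arcs[OF induced_graph_imp_graph]
      wf_digraph.symmetric_connected_imp_strongly_connected[OF wf_digraphI_induced] by blast
  have "max_subgraph strongly_connected H" if H: "max_subgraph Digraph_Component.connected H" for H
  proof -
    have "strongly_connected H"
      using induced_subgraphI_arc_mono[OF H arc_mono_connected] max_subgraph_prop[OF H]
      by (rule induced)
    \<comment> \<open>Every strongly connected supergraph of \<open>H\<close> is connected, so
      maximality carries over.\<close>
    then show ?thesis
      using H unfolding max_subgraph_def
      by (meson subgraphE wf_digraph.strongly_connected_imp_connected)
  qed
  moreover have "max_subgraph Digraph_Component.connected H"
    if H: "max_subgraph strongly_connected H" for H
  proof (rule max_subgraphI)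
    show sub: "subgraph H G" using H by (rule subgraphI_max_subgraph)
    then have "wf_digraph H" by blast
    then show "Digraph_Component.connected H"
      by (rule wf_digraph.strongly_connected_imp_connected) (rule max_subgraph_prop[OF H])
    fix K assume K: "H \<noteq> K" "subgraph H K" "subgraph K G"
    show "\<not> Digraph_Component.connected K"
    proof
      assume "Digraph_Component.connected K"
      \<comment> \<open>\<open>K\<close> may contain an arc without its reverse, so it need not be
        strongly connected; the subgraph induced on its vertices is.\<close>
      let ?K = "G \<restriction> verts K"
      have KK: "subgraph K ?K" and KG: "induced_subgraph ?K G"
        using K by (auto intro: subgraph_induce_subgraphI2)
      have "Digraph_Component.connected ?K"
        using arc_mono_connected KK \<open>Digraph_Component.connected K\<close>
        unfolding arc_mono_def by (metis induce_subgraph_verts)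
      then have "strongly_connected ?K" using KG by (intro induced)
      moreover have "subgraph H ?K" using K(2) KK by (rule subgraph_trans)
      moreover have "subgraph ?K G" using KG by (rule induced_imp_subgraph)
      ultimately have "?K = H"
        using H unfolding max_subgraph_def by blast
      \<comment> \<open>\<open>K\<close> is squeezed between \<open>H\<close> and
        \<open>?K\<close>.\<close>
      then have "H = K"
        using K(2) KK by (auto simp: subgraph_def compatible_def)
      then show False using K(1) by blast
    qed
  qed
  ultimately show ?thesis
    unfolding connected_components_def sccs_altdef2 by blast
qed

text \<open>Strong components correspond one-to-one to their vertex sets, which are the classes
  \<open>scc_of x\<close>; counting sets of vertices avoids handling subgraphs.\<close>

lemma (in sym_digraph) card_connected_components:
  "card (connected_components G) = card (scc_of ` verts G)"
  by (simp add: connected_components_eq_sccs sccs_verts_conv_scc_of flip: card_sccs_verts)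

section \<open>Blocks of a colored complete bipartite graph\<close>

lemma arcs_ends_monochromatic_subgraph:
  "arcs_ends (monochromatic_subgraph G c) = {(x, y) \<in> arcs_ends G. c x = c y}"
  by (auto simp: arcs_ends_conv monochromatic_subgraph_def)

lemma verts_monochromatic_subgraph [simp]: "verts (monochromatic_subgraph G c) = verts G"
  by (simp add: monochromatic_subgraph_def)

lemma (in sym_digraph) sym_digraph_monochromatic_subgraph:
  "sym_digraph (monochromatic_subgraph G c)"
proof -
  have "wf_digraph (monochromatic_subgraph G c)"
    by unfold_locales (auto simp: monochromatic_subgraph_def)
  moreover have "symmetric (monochromatic_subgraph G c)"
    unfolding symmetric_def arcs_ends_monochromatic_subgraph
    by (auto intro!: symI graph_symmetric)
  ultimately show ?thesis by (rule wf_digraph.sym_digraphI)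
qed

lemma card_blocks_complete_bipartite:
  assumes "sym_digraph G" and fin: "finite U" "finite V"
    and verts: "verts G = U \<union> V" and disj: "U \<inter> V = {}"
    and arcs: "arcs_ends G = U \<times> V \<union> V \<times> U"
  shows "card (blocks G c) =
    card {u \<in> U. c u \<notin> c ` V} + card {v \<in> V. c v \<notin> c ` U} + card (c ` U \<inter> c ` V)"
proof -
  interpret G: sym_digraph G by fact
  interpret M: sym_digraph "monochromatic_subgraph G c"
    by (rule G.sym_digraph_monochromatic_subgraph)
  let ?M = "monochromatic_subgraph G c"
  define A B C F where "A = {u \<in> U. c u \<notin> c ` V}" and "B = {v \<in> V. c v \<notin> c ` U}"
    and "C = c ` U \<inter> c ` V" and "F = (\<lambda>i. {x \<in> U \<union> V. c x = i})"
  have adj: "x \<rightarrow>\<^bsub>?M\<^esub> y \<longleftrightarrow> (x, y) \<in> U \<times> V \<union> V \<times> U \<and> c x = c y" for x y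
    by (auto simp: arcs_ends_monochromatic_subgraph arcs)
  have same_color: "c x = c y" if "x \<rightarrow>\<^sup>*\<^bsub>?M\<^esub> y" for x y
    using that by (induction rule: M.reachable_induct) (auto simp: adj)
  have lonely: "M.scc_of x = {x}" if x: "x \<in> A \<union> B" for x
  proof -
    \<comment> \<open>The first arc of a nontrivial walk from \<open>x\<close> would end at a vertex
      of the same color in the opposite part.\<close>
    have "y = x" if "x \<rightarrow>\<^sup>*\<^bsub>?M\<^esub> y" for y
      using that
    proof (cases rule: M.converse_reachable_cases)
      case (step z)
      then show ?thesis using x disj by (auto simp: adj A_def B_def)
    qed simp
    moreover have "x \<in> verts ?M" using x by (auto simp: A_def B_def verts)
    ultimately show ?thesis unfolding M.scc_of_def by auto
  qed
  have common: "M.scc_of x = F (c x)" if x: "x \<in> U \<union> V" "c x \<in> C" for x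
  proof -
    obtain u v where uv: "u \<in> U" "v \<in> V" "c u = c x" "c v = c x"
      using x(2) by (auto simp: C_def)
    \<comment> \<open>A vertex of this color in \<open>V\<close> is adjacent to \<open>u\<close>;
      one in \<open>U\<close> reaches \<open>u\<close> through \<open>v\<close>.\<close>
    have to_u: "y \<rightarrow>\<^sup>*\<^bsub>?M\<^esub> u" if "y \<in> F (c x)" for y
    proof (cases "y \<in> V")
      case True
      then show ?thesis using that uv by (intro M.reachable_adjI) (auto simp: adj F_def)
    next
      case False
      then have "y \<rightarrow>\<^bsub>?M\<^esub> v" "v \<rightarrow>\<^bsub>?M\<^esub> u" using that uv by (auto simp: adj F_def)
      then show ?thesis by (meson M.adj_reachable_trans M.reachable_adjI)
    qed
    have "y \<in> M.scc_of x" if "y \<in> F (c x)" for y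
    proof (rule M.scc_ofI_reachable)
      have "u \<rightarrow>\<^sup>*\<^bsub>?M\<^esub> x"
        using to_u[of x] x(1) by (auto simp: F_def symmetric_reachable[OF M.sym_arcs])
      then show "y \<rightarrow>\<^sup>*\<^bsub>?M\<^esub> x" using to_u[OF that] by (rule M.reachable_trans[rotated])
    qed
    moreover have "y \<in> F (c x)" if "y \<in> M.scc_of x" for y
      using that same_color[of x y] M.reachable_in_verts[of x y]
      by (auto simp: M.scc_of_def F_def verts)
    ultimately show ?thesis by blast
  qed
  have split: "U \<union> V = (A \<union> B) \<union> {x \<in> U \<union> V. c x \<in> C}"
    by (auto simp: A_def B_def C_def)
  have "M.scc_of ` verts ?M = M.scc_of ` (A \<union> B) \<union> M.scc_of ` {x \<in> U \<union> V. c x \<in> C}"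
    by (simp only: verts_monochromatic_subgraph verts image_Un[symmetric] split[symmetric])
  also have "M.scc_of ` (A \<union> B) = (\<lambda>x. {x}) ` (A \<union> B)"
    by (rule image_cong) (auto simp: lonely)
  also have "M.scc_of ` {x \<in> U \<union> V. c x \<in> C} = F ` c ` {x \<in> U \<union> V. c x \<in> C}"
    unfolding image_image by (rule image_cong) (auto simp: common)
  also have "c ` {x \<in> U \<union> V. c x \<in> C} = C" by (auto simp: C_def)
  finally have eq: "M.scc_of ` verts ?M = (\<lambda>x. {x}) ` (A \<union> B) \<union> F ` C" .
  \<comment> \<open>A color class meeting both disjoint parts has at least two vertices, so no block
    is counted both as a singleton and as a class.\<close>
  have "F i \<noteq> {x}" if i: "i \<in> C" for i x
  proof
    assume F: "F i = {x}"
    obtain u v where "u \<in> U" "v \<in> V" "c u = i" "c v = i"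
      using i by (auto simp: C_def)
    then have "u \<in> F i" "v \<in> F i" "u \<noteq> v" using disj by (auto simp: F_def)
    then show False using F by simp
  qed
  then have disj': "(\<lambda>x. {x}) ` (A \<union> B) \<inter> F ` C = {}" by fastforce
  have inj: "inj_on F C" by (rule inj_onI) (fastforce simp: F_def C_def)
  have fins: "finite A" "finite B" "finite C" "A \<inter> B = {}"
    using fin disj by (auto simp: A_def B_def C_def)
  have "card (blocks G c) = card ((\<lambda>x. {x}) ` (A \<union> B) \<union> F ` C)"
    by (simp only: blocks_def M.card_connected_components eq)
  also have "\<dots> = card ((\<lambda>x. {x}) ` (A \<union> B)) + card (F ` C)"
    using fins disj' by (intro card_Un_disjoint) auto
  also have "\<dots> = card A + card B + card C"
    using fins inj by (simp add: card_image card_Un_disjoint)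
  finally show ?thesis by (simp only: A_def B_def C_def)
qed

section \<open>Probabilities in a uniform coloring\<close>

text \<open>The event is a product set, so by independence its probability is a product over the
  vertices; those outside \<open>S\<close> contribute the factor 1.\<close>

lemma prob_uniform_coloring_avoids:
  assumes "finite (verts G)" "S \<subseteq> verts G" "i < k"
  shows "measure_pmf.prob (uniform_coloring k G) {c. i \<notin> c ` S} = ((real k - 1) / real k) ^ card S"
proof -
  let ?B = "\<lambda>x. if x \<in> S then - {i} else UNIV"
  have "{c. i \<notin> c ` S} = Pi (verts G) ?B" using assms(2) by (auto simp: Pi_def)
  then have "measure_pmf.prob (uniform_coloring k G) {c. i \<notin> c ` S} =
      (\<Prod>x\<in>verts G. measure_pmf.prob (pmf_of_set {..<k}) (?B x))"
    using assms(1) by (simp only: uniform_coloring_def measure_Pi_pmf_Pi)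
  also have "\<dots> = (\<Prod>x\<in>verts G. if x \<in> S then (real k - 1) / real k else 1)"
  proof (rule prod.cong[OF refl])
    have "{..<k} \<inter> - {i} = {..<k} - {i}" by auto
    then show "measure_pmf.prob (pmf_of_set {..<k}) (?B x) =
        (if x \<in> S then (real k - 1) / real k else 1)" for x
      using assms(3) by (auto simp: measure_pmf_of_set lessThan_empty_iff of_nat_diff)
  qed
  also have "\<dots> = ((real k - 1) / real k) ^ card S"
    using assms(1,2) by (simp add: prod.If_cases Int_absorb1)
  finally show ?thesis .
qed

text \<open>Split by the color \<open>i\<close> of \<open>u\<close>: since \<open>u\<close> lies
  outside \<open>S\<close>, each of the \<open>k\<close> colors contributes the avoidance
  probability divided by \<open>k\<close>.\<close>

lemma prob_uniform_coloring_lonely: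
  assumes "finite (verts G)" "S \<subseteq> verts G" "u \<in> verts G" "u \<notin> S" "k \<ge> 1"
  shows "measure_pmf.prob (uniform_coloring k G) {c. c u \<notin> c ` S} =
    ((real k - 1) / real k) ^ card S"
proof -
  let ?P = "measure_pmf.prob (uniform_coloring k G)"
  let ?q = "(real k - 1) / real k"
  have color: "?P {c. c u = i \<and> i \<notin> c ` S} = ?q ^ card S / real k" if "i < k" for i
  proof -
    let ?B = "\<lambda>x. if x = u then {i} else if x \<in> S then - {i} else UNIV"
    have "{c. c u = i \<and> i \<notin> c ` S} = Pi (verts G) ?B"
      using assms(2-4) by (auto simp: Pi_def image_iff)
    then have "?P {c. c u = i \<and> i \<notin> c ` S} =
        (\<Prod>x\<in>verts G. measure_pmf.prob (pmf_of_set {..<k}) (?B x))"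
      using assms(1) by (simp only: uniform_coloring_def measure_Pi_pmf_Pi)
    also have "\<dots> = (\<Prod>x\<in>verts G. (if x \<in> S then ?q else 1) * (if x = u then 1 / real k else 1))"
    proof (rule prod.cong[OF refl])
      have "{..<k} \<inter> - {i} = {..<k} - {i}" "{..<k} \<inter> {i} = {i}" using that by auto
      then show "measure_pmf.prob (pmf_of_set {..<k}) (?B x) =
          (if x \<in> S then ?q else 1) * (if x = u then 1 / real k else 1)" for x
        using that assms(4) by (auto simp: measure_pmf_of_set lessThan_empty_iff of_nat_diff)
    qed
    also have "\<dots> = ?q ^ card S / real k"
      using assms(1-3) by (simp add: prod.distrib prod.If_cases Int_absorb1)
    finally show ?thesis .
  qed
  have u_color: "c u < k" if "c \<in> set_pmf (uniform_coloring k G)" for c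
    using that assms(1,3,5)
    by (auto simp: uniform_coloring_def set_Pi_pmf PiE_dflt_def set_pmf_of_set lessThan_empty_iff)
  \<comment> \<open>The two events agree only on the support, where the color of \<open>u\<close> is
    below \<open>k\<close>.\<close>
  have "?P {c. c u \<notin> c ` S} = ?P (\<Union>i<k. {c. c u = i \<and> i \<notin> c ` S})"
    by (rule measure_prob_cong_0) (use u_color in \<open>auto simp: set_pmf_eq\<close>)
  also have "\<dots> = (\<Sum>i<k. ?P {c. c u = i \<and> i \<notin> c ` S})"
    by (rule measure_pmf.finite_measure_finite_Union) (auto simp: disjoint_family_on_def)
  also have "\<dots> = ?q ^ card S"
    using assms(5) by (simp add: color)
  finally show ?thesis .
qed

text \<open>Inclusion-exclusion on the complement: missing from both parts means missing from their
  disjoint union, and the resulting expression factors.\<close>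

lemma prob_uniform_coloring_common_color:
  assumes "finite (verts G)" "U \<union> V \<subseteq> verts G" "U \<inter> V = {}" "i < k"
  shows "measure_pmf.prob (uniform_coloring k G) {c. i \<in> c ` U \<inter> c ` V} =
    (1 - ((real k - 1) / real k) ^ card U) * (1 - ((real k - 1) / real k) ^ card V)"
proof -
  let ?P = "measure_pmf.prob (uniform_coloring k G)"
  let ?N = "\<lambda>S. {c. i \<notin> c ` S}"
  have fin: "finite U" "finite V" using assms(1,2) by (auto intro: finite_subset)
  have "{c. i \<in> c ` U \<inter> c ` V} = UNIV - (?N U \<union> ?N V)" by auto
  then have "?P {c. i \<in> c ` U \<inter> c ` V} = 1 - ?P (?N U \<union> ?N V)"
    using measure_pmf.prob_compl[of "?N U \<union> ?N V" "uniform_coloring k G"] by simp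
  also have "?P (?N U \<union> ?N V) = ?P (?N U) + ?P (?N V) - ?P (?N U \<inter> ?N V)"
    by (rule measure_Un3) (auto simp: fmeasurable_def measure_pmf.emeasure_eq_measure)
  also have "?N U \<inter> ?N V = ?N (U \<union> V)" by auto
  finally show ?thesis
    using assms fin
    by (simp add: prob_uniform_coloring_avoids card_Un_disjoint power_add algebra_simps)
qed

text \<open>Linearity of expectation, with the cardinality written as a sum of indicators over the
  fixed index set \<open>A\<close>.\<close>

lemma expectation_card_Collect:
  fixes p :: "'c pmf"
  assumes "finite A"
  shows "measure_pmf.expectation p (\<lambda>c. real (card {x \<in> A. Q c x})) =
    (\<Sum>x\<in>A. measure_pmf.prob p {c. Q c x})"
proof -
  have "real (card {x \<in> A. Q c x}) = (\<Sum>x\<in>A. indicator {c. Q c x} c)" for c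
    using assms by (simp add: indicator_def sum.If_cases Collect_conj_eq Int_commute)
  then have "measure_pmf.expectation p (\<lambda>c. real (card {x \<in> A. Q c x})) =
      measure_pmf.expectation p (\<lambda>c. \<Sum>x\<in>A. indicator {c. Q c x} c)"
    by presburger
  also have "\<dots> = (\<Sum>x\<in>A. measure_pmf.expectation p (indicator {c. Q c x}))"
    by (intro Bochner_Integration.integral_sum integrable_real_indicator)
      (auto simp: measure_pmf.emeasure_eq_measure)
  finally show ?thesis by simp
qed

theorem theorem5p1:
  fixes k n m :: nat and G :: "('a, 'b) pre_digraph"
  assumes "k \<ge> 1" "n \<ge> 1" "m \<ge> 1"
    and "K\<^bsub>n,m\<^esub> G"
  shows "expected_blocks k G =
    (real n * real k ^ n * (real k - 1) ^ m + real m * real k ^ m * (real k - 1) ^ n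
      + real k * (real k ^ n - (real k - 1) ^ n) * (real k ^ m - (real k - 1) ^ m))
    / real k ^ (n + m)"
proof -
  interpret graph G using assms(4) by (simp add: complete_bipartite_digraph_def)
  obtain U V where verts: "verts G = U \<union> V" and disj: "U \<inter> V = {}"
    and card: "card U = n" "card V = m" and arcs: "arcs_ends G = U \<times> V \<union> V \<times> U"
    using assms(4) by (auto simp: complete_bipartite_digraph_def)
  have fin: "finite U" "finite V" using finite_verts verts by auto
  let ?p = "uniform_coloring k G"
  let ?q = "(real k - 1) / real k"
  let ?E = "measure_pmf.expectation ?p"
  \<comment> \<open>In \<open>d\<close> the index ranges over all \<open>k\<close> colors, so that
    the index set does not depend on \<open>c\<close>; on the support this gives the same count as
    \<open>c\<close> U \<inter> c \<open>V\<close>.\<close>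
  define a b d where "a = (\<lambda>c :: 'a \<Rightarrow> nat. real (card {u \<in> U. c u \<notin> c ` V}))"
    and "b = (\<lambda>c :: 'a \<Rightarrow> nat. real (card {v \<in> V. c v \<notin> c ` U}))"
    and "d = (\<lambda>c :: 'a \<Rightarrow> nat. real (card {i \<in> {..<k}. i \<in> c ` U \<inter> c ` V}))"
  have coloring: "set_pmf ?p = PiE_dflt (verts G) 0 (\<lambda>_. {..<k})"
    using assms(1) by (simp add: uniform_coloring_def set_Pi_pmf set_pmf_of_set lessThan_empty_iff)
  \<comment> \<open>Finite support makes every real function of the coloring integrable, as
    linearity requires.\<close>
  then have "finite (set_pmf ?p)" by (auto intro!: finite_PiE_dflt)
  then have integrable: "integrable (measure_pmf ?p) f" for f :: "_ \<Rightarrow> real"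
    by (rule integrable_measure_pmf_finite)
  have "expected_blocks k G = ?E (\<lambda>c. a c + b c + d c)"
    unfolding expected_blocks_def
  proof (intro integral_cong_AE AE_pmfI)
    fix c assume "c \<in> set_pmf ?p"
    then have "c ` U \<inter> c ` V = {i \<in> {..<k}. i \<in> c ` U \<inter> c ` V}"
      by (auto simp: coloring PiE_dflt_def verts)
    then show "real (card (blocks G c)) = a c + b c + d c"
      using card_blocks_complete_bipartite[OF sym_digraph_axioms fin verts disj arcs, of c]
      unfolding a_def b_def d_def by simp
  qed auto
  also have "\<dots> = ?E a + ?E b + ?E d"
    by (simp add: integrable)
  also have "?E a = real n * ?q ^ m"
    using fin disj assms(1)
    by (simp add: a_def expectation_card_Collect prob_uniform_coloring_lonely verts
        disjoint_iff flip: card)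
  also have "?E b = real m * ?q ^ n"
    using fin disj[unfolded Int_commute[of U]] assms(1)
    by (simp add: b_def expectation_card_Collect prob_uniform_coloring_lonely verts
        disjoint_iff flip: card)
  also have "?E d = real k * ((1 - ?q ^ n) * (1 - ?q ^ m))"
    unfolding d_def using fin disj
    by (subst expectation_card_Collect) (simp_all add: prob_uniform_coloring_common_color verts card del: Int_iff)
  also have "real n * ?q ^ m + real m * ?q ^ n + real k * ((1 - ?q ^ n) * (1 - ?q ^ m)) =
    (real n * real k ^ n * (real k - 1) ^ m + real m * real k ^ m * (real k - 1) ^ n
      + real k * (real k ^ n - (real k - 1) ^ n) * (real k ^ m - (real k - 1) ^ m))
    / real k ^ (n + m)"
    using assms(1) by (simp add: power_divide power_add field_simps)
  finally show ?thesis .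
qed

end
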